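(* Let $2\le p<\infty$. There is a positive constant $C$ (depending only on $p$) such that for all pure unit quaternions $\lambda,\mu$, all $a_l,b_l,c_l,d_l,\tau_l,\eta_l\in\mathbb R$ with $a_ld_l-b_lc_l=1$ and $b_l\neq0$ ($l=1,2$), and all $f,g\in L^2(\mathbb R^2,\mathbb H)$, $$\int_{\mathbb R^2}\int_{\mathbb R^2}\left|\mathcal W^{A_1,A_2}_{f,g}(t,u)\right|_Q^p\,du\,dt\ \le\ C\,\frac{|b_1b_2|^{-\frac p2+1}}{(2\pi)^p}\,|f|_{2,Q}^p\,|g|_{2,Q}^p .$$
   Context: $\mathbb H$ is the skew field of real quaternions with conjugation $q\mapsto\overline q$ and modulus $|q|_Q=\sqrt{q\overline q}$. A pure unit quaternion is $\lambda\in\mathbb H$ with $\lambda^2=-1$, and $e^{\lambda\theta}=\cos\theta+\lambda\sin\theta$ for $\theta\in\mathbb R$. For $f:\mathbb R^2\to\mathbb H$, $|f|_{2,Q}=\left(\int_{\mathbb R^2}|f(t)|_Q^2\,dt\right)^{1/2}$, and $L^2(\mathbb R^2,\mathbb H)$ is the space of measurable $f$ with $|f|_{2,Q}<\infty$. $A_l$ stands for the parameter tuple $(a_l,b_l,c_l,d_l,\tau_l,\eta_l)$. For $b_l\neq0$ and a pure unit quaternion $\nu$, the kernel is $$K^{\nu}_{A_l}(x,y)=\frac{1}{\sqrt{\nu 2\pi b_l}}\exp\!\Big(\frac{\nu}{2b_l}\big(a_lx^2-2x(y-\tau_l)-2y(d_l\tau_l-b_l\eta_l)+d_l(y^2+\tau_l^2)\big)\Big),\qquad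 x,y\in\mathbb R,$$ where $\frac1{\sqrt\nu}=e^{-\nu\pi/4}$; square roots are principal square roots in the copy $\mathbb R+\mathbb R\nu$ of $\mathbb C$, so that the prefactor has modulus $(2\pi|b_l|)^{-1/2}$. For $f,g\in L^2(\mathbb R^2,\mathbb H)$ and $b_1,b_2\neq0$, the Wigner-Ville distribution associated with the two-sided quaternionic offset linear canonical transform (WVD-QOLCT) is $$\mathcal W^{A_1,A_2}_{f,g}(t,u)=\int_{\mathbb R^2}K^{\lambda}_{A_1}(s_1,u_1)\,f\!\left(t+\tfrac s2\right)\overline{g\!\left(t-\tfrac s2\right)}\,K^{\mu}_{A_2}(s_2,u_2)\,ds,\qquad t,u\in\mathbb R^2 .$$ *)

theory Defs
  imports "HOL-Analysis.Analysis"
begin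

section \<open>The skew field of real quaternions\<close>

datatype quat = Quat (qre: real) (qi: real) (qj: real) (qk: real)

lemma quat_eq_iff: "x = y \<longleftrightarrow> qre x = qre y \<and> qi x = qi y \<and> qj x = qj y \<and> qk x = qk y"
  by (auto intro: quat.expand)

instantiation quat :: ring_1
begin

definition "0 = Quat 0 0 0 0"
definition "1 = Quat 1 0 0 0"
definition "- x = Quat (- qre x) (- qi x) (- qj x) (- qk x)"
definition "x + y = Quat (qre x + qre y) (qi x + qi y) (qj x + qj y) (qk x + qk y)"
definition "x - y = Quat (qre x - qre y) (qi x - qi y) (qj x - qj y) (qk x - qk y)"
definition "x * y = Quat
  (qre x * qre y - qi x * qi y - qj x * qj y - qk x * qk y)
  (qre x * qi y + qi x * qre y + qj x * qk y - qk x * qj y)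
  (qre x * qj y - qi x * qk y + qj x * qre y + qk x * qi y)
  (qre x * qk y + qi x * qj y - qj x * qi y + qk x * qre y)"

lemmas quat_ring_defs = zero_quat_def one_quat_def uminus_quat_def plus_quat_def
  minus_quat_def times_quat_def

instance
  by standard (simp_all add: quat_ring_defs algebra_simps)

end

instantiation quat :: real_vector
begin

definition "scaleR r x = Quat (r * qre x) (r * qi x) (r * qj x) (r * qk x)"

instance
  by standard (simp_all add: quat_ring_defs scaleR_quat_def algebra_simps)

end

instantiation quat :: real_inner
begin

definition "inner x y = qre x * qre y + qi x * qi y + qj x * qj y + qk x * qk y"
definition "norm x = sqrt ((qre x)\<^sup>2 + (qi x)\<^sup>2 + (qj x)\<^sup>2 + (qk x)\<^sup>2)" for x :: quat
definition "sgn x = x /\<^sub>R norm x" for x :: quat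
definition "dist x y = norm (x - y)" for x y :: quat
definition "(uniformity :: (quat \<times> quat) filter) =
  (INF e\<in>{0 <..}. principal {(x, y). dist x y < e})"
definition "open (U :: quat set) \<longleftrightarrow>
  (\<forall>x\<in>U. eventually (\<lambda>(x', y). x' = x \<longrightarrow> y \<in> U) uniformity)"

instance
proof
  fix x y z :: quat and r :: real and U :: "quat set"
  show "dist x y = norm (x - y)" "sgn x = x /\<^sub>R norm x"
    "(uniformity :: (quat \<times> quat) filter) = (INF e\<in>{0<..}. principal {(x, y). dist x y < e})"
    "open U \<longleftrightarrow> (\<forall>x\<in>U. \<forall>\<^sub>F (x', y) in uniformity. x' = x \<longrightarrow> y \<in> U)"
    by (rule dist_quat_def sgn_quat_def uniformity_quat_def open_quat_def)+
  show "inner x y = inner y x"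
    by (simp add: inner_quat_def mult.commute)
  show "inner (x + y) z = inner x z + inner y z"
    by (simp add: inner_quat_def plus_quat_def algebra_simps)
  show "inner (r *\<^sub>R x) y = r * inner x y"
    by (simp add: inner_quat_def scaleR_quat_def algebra_simps)
  show "0 \<le> inner x x"
    by (simp add: inner_quat_def)
  show "inner x x = 0 \<longleftrightarrow> x = 0"
    unfolding inner_quat_def zero_quat_def quat_eq_iff quat.sel
    by (smt (verit) mult_eq_0_iff zero_le_square)
  show "norm x = sqrt (inner x x)"
    by (simp add: norm_quat_def inner_quat_def power2_eq_square)
qed

end

instantiation quat :: real_normed_div_algebra
begin

definition "inverse x = Quat (qre x / (norm x)\<^sup>2) (- qi x / (norm x)\<^sup>2)
    (- qj x / (norm x)\<^sup>2) (- qk x / (norm x)\<^sup>2)" for x :: quat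
definition "x div y = x * inverse y" for x y :: quat

lemma quat_norm_sq: "(norm x)\<^sup>2 = (qre x)\<^sup>2 + (qi x)\<^sup>2 + (qj x)\<^sup>2 + (qk x)\<^sup>2"
  for x :: quat
  by (simp add: norm_quat_def)

instance
proof
  fix x y :: quat
  show "inverse x * x = 1" "x * inverse x = 1" if "x \<noteq> 0"
  proof -
    define n where "n = (norm x)\<^sup>2"
    have "n \<noteq> 0" using that by (simp add: n_def)
    moreover have "qre x * qre x + qi x * qi x + qj x * qj x + qk x * qk x = n"
      by (simp add: n_def quat_norm_sq flip: power2_eq_square)
    moreover have "inverse x = Quat (qre x / n) (- qi x / n) (- qj x / n) (- qk x / n)"
      by (simp add: inverse_quat_def n_def)
    ultimately show "inverse x * x = 1" "x * inverse x = 1"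
      by (simp_all add: times_quat_def one_quat_def mult.commute
          flip: add_divide_distrib diff_divide_distrib)
  qed
  show "norm (x * y) = norm x * norm y"
    unfolding norm_quat_def real_sqrt_mult[symmetric]
    by (rule arg_cong[where f = sqrt]) (simp add: times_quat_def power2_eq_square algebra_simps)
qed (simp_all add: divide_quat_def inverse_quat_def quat_ring_defs scaleR_quat_def quat_eq_iff
      algebra_simps)

end

instantiation quat :: euclidean_space
begin

definition "Basis = {Quat 1 0 0 0, Quat 0 1 0 0, Quat 0 0 1 0, Quat 0 0 0 1}"

instance
proof
  fix u v x :: quat
  show "(Basis :: quat set) \<noteq> {}" "finite (Basis :: quat set)"
    by (simp_all add: Basis_quat_def)
  show "inner u v = (if u = v then 1 else 0)" if "u \<in> Basis" "v \<in> Basis"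
    using that unfolding Basis_quat_def by (elim insertE emptyE) (simp_all add: inner_quat_def)
  show "(\<forall>u\<in>Basis. inner x u = 0) \<longleftrightarrow> x = 0"
    by (cases x) (simp add: Basis_quat_def inner_quat_def zero_quat_def)
qed

end

definition qcnj :: "quat \<Rightarrow> quat" where
  "qcnj q = Quat (qre q) (- qi q) (- qj q) (- qk q)"

lemma mult_qcnj: "q * qcnj q = of_real ((norm q)\<^sup>2)" "qcnj q * q = of_real ((norm q)\<^sup>2)"
  by (simp_all add: quat_norm_sq of_real_def qcnj_def times_quat_def scaleR_quat_def one_quat_def
      mult.commute flip: power2_eq_square)

definition pure_unit :: "quat \<Rightarrow> bool" where
  "pure_unit \<nu> \<longleftrightarrow> \<nu>\<^sup>2 = - 1"

text \<open>For a pure unit quaternion \<open>\<nu>\<close>, the map \<open>slice \<nu>\<close> identifies \<open>\<complex>\<close> with the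
  subfield \<open>\<real> + \<real>\<nu>\<close> of the quaternions.\<close>

definition slice :: "quat \<Rightarrow> complex \<Rightarrow> quat" where
  "slice \<nu> z = of_real (Re z) + Im z *\<^sub>R \<nu>"

lemma slice_mult:
  assumes "pure_unit \<nu>"
  shows "slice \<nu> (z * w) = slice \<nu> z * slice \<nu> w"
proof -
  have "\<nu> * \<nu> = - 1" using assms by (simp add: pure_unit_def power2_eq_square)
  then show ?thesis
    by (simp add: slice_def of_real_def algebra_simps)
qed

text \<open>\<open>qexp \<nu> \<theta>\<close> is $e^{\nu\theta}$ for real \<open>\<theta>\<close>.\<close>

definition qexp :: "quat \<Rightarrow> real \<Rightarrow> quat" where
  "qexp \<nu> \<theta> = of_real (cos \<theta>) + sin \<theta> *\<^sub>R \<nu>"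

lemma slice_inverse_csqrt: "slice \<nu> (1 / csqrt \<i>) = qexp \<nu> (- pi / 4)"
proof -
  have "1 / csqrt \<i> = cis (- pi / 4)"
    by (simp add: complex_eq_iff Re_divide Im_divide cos_45 sin_45 real_sqrt_divide
        field_simps power2_eq_square)
  then show ?thesis by (simp add: slice_def qexp_def)
qed


section \<open>The two-sided quaternionic offset linear canonical transform\<close>

text \<open>A parameter tuple is \<open>(a, b, c, d, \<tau>, \<eta>)\<close>; the entry \<open>c\<close> enters only through the
  determinant condition \<open>a * d - b * c = 1\<close>.\<close>

type_synonym olct_params = "real \<times> real \<times> real \<times> real \<times> real \<times> real"

text \<open>\<open>1 / csqrt (\<i> * 2 * pi * b)\<close> is the principal branch, transported to \<open>\<real> + \<real>\<nu>\<close>; for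
  \<open>b < 0\<close> it has argument $+\pi/4$.\<close>

fun olct_kernel :: "quat \<Rightarrow> olct_params \<Rightarrow> real \<Rightarrow> real \<Rightarrow> quat" where
  "olct_kernel \<nu> (a, b, c, d, \<tau>, \<eta>) x y =
     slice \<nu> (1 / csqrt (\<i> * 2 * pi * b)) *
     qexp \<nu> (1 / (2 * b) *
       (a * x\<^sup>2 - 2 * x * (y - \<tau>) - 2 * y * (d * \<tau> - b * \<eta>) + d * (y\<^sup>2 + \<tau>\<^sup>2)))"

definition L2_space :: "(real \<times> real \<Rightarrow> quat) set" where
  "L2_space = {f. f \<in> borel_measurable lebesgue \<and> integrable lebesgue (\<lambda>t. (norm (f t))\<^sup>2)}"

definition L2_norm :: "(real \<times> real \<Rightarrow> quat) \<Rightarrow> real" where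
  "L2_norm f = sqrt (LINT t|lebesgue. (norm (f t))\<^sup>2)"

definition wvd_qolct ::
  "quat \<Rightarrow> quat \<Rightarrow> olct_params \<Rightarrow> olct_params \<Rightarrow> (real \<times> real \<Rightarrow> quat) \<Rightarrow> (real \<times> real \<Rightarrow> quat)
   \<Rightarrow> real \<times> real \<Rightarrow> real \<times> real \<Rightarrow> quat" where
  "wvd_qolct \<nu> \<mu> A1 A2 f g t u =
     (LINT s|lebesgue. olct_kernel \<nu> A1 (fst s) (fst u) * f (t + s /\<^sub>R 2) * qcnj (g (t - s /\<^sub>R 2))
        * olct_kernel \<mu> A2 (snd s) (snd u))"

end

theory Submission
  imports Defs "HOL-Probability.Characteristic_Functions"
begin

text \<open>No interpolation is needed. By Cauchy-Schwarz the distribution is bounded pointwise by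
  \<open>M = 4 |f| |g| / (2 \<pi> sqrt |b1 b2|)\<close>, and its \<open>L\<^sup>2\<close> norm over \<open>(t, u)\<close> is at most \<open>|f| |g|\<close>; then
  \<open>|W|\<^sup>p \<le> M\<^bsup>p-2\<^esup> |W|\<^sup>2\<close> gives the claim. For the \<open>L\<^sup>2\<close> bound, stripping
  unimodular factors from the kernels leaves a Plancherel inequality for the two-sided quaternionic
  Fourier transform. To prove it, weight the squared transform with a wide Gaussian: by Fubini the
  weighted integral is the double integral of \<open>\<langle>h(s), h(s')\<rangle>\<close> against a narrow Gaussian in \<open>s - s'\<close>,
  which AM-GM bounds by the squared \<open>L\<^sup>2\<close> norm of \<open>h\<close>. Fatou's lemma removes the weight.\<close>

section \<open>Quaternion algebra: slices, exponentials and the inner product\<close>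

lemma qexp_slice: "qexp \<nu> \<theta> = slice \<nu> (cis \<theta>)"
  by (simp add: qexp_def slice_def)

lemma qexp_add: "pure_unit \<nu> \<Longrightarrow> qexp \<nu> (a + b) = qexp \<nu> a * qexp \<nu> b"
  by (simp add: qexp_slice slice_mult flip: cis_mult)

text \<open>The imaginary components of \<open>\<nu> * \<nu>\<close> are
  \<open>2 * qre \<nu>\<close> times those of \<open>\<nu>\<close>. A nonzero real part would
  therefore force \<open>\<nu>\<close> to be real with square -1.\<close>

lemma pure_unit_qre:
  assumes "pure_unit \<nu>"
  shows "qre \<nu> = 0"
proof (rule ccontr)
  assume r: "qre \<nu> \<noteq> 0"
  have eq: "\<nu> * \<nu> = - 1" using assms by (simp add: pure_unit_def power2_eq_square)
  with r have "qi \<nu> = 0" "qj \<nu> = 0" "qk \<nu> = 0"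
    by (simp_all add: quat_eq_iff quat_ring_defs)
  with eq have "qre \<nu> * qre \<nu> = - 1" by (simp add: quat_eq_iff quat_ring_defs)
  then show False by (smt (verit) zero_le_square)
qed

lemma norm_pure_unit: "pure_unit \<nu> \<Longrightarrow> norm \<nu> = 1"
proof -
  assume "pure_unit \<nu>"
  then have "(norm \<nu>)\<^sup>2 = 1" by (simp add: pure_unit_def flip: norm_power)
  then show ?thesis by (smt (verit) norm_ge_zero power2_eq_1_iff)
qed

text \<open>A pure unit quaternion has real part 0 and norm 1, so \<open>1\<close> and
  \<open>\<nu>\<close> are orthonormal and the embedding of the complex plane is isometric.\<close>

lemma norm_slice:
  assumes "pure_unit \<nu>"
  shows "norm (slice \<nu> z) = cmod z"
proof -
  have "(norm (slice \<nu> z))\<^sup>2 = (Re z)\<^sup>2 + (Im z)\<^sup>2 * (norm \<nu>)\<^sup>2"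
    by (simp add: quat_norm_sq slice_def of_real_def quat_ring_defs scaleR_quat_def pure_unit_qre[OF
        assms]
        algebra_simps power_mult_distrib)
  also have "\<dots> = (cmod z)\<^sup>2" by (simp add: norm_pure_unit[OF assms] cmod_power2)
  finally show ?thesis by simp
qed

lemma norm_qexp: "pure_unit \<nu> \<Longrightarrow> norm (qexp \<nu> \<theta>) = 1"
  by (simp add: qexp_slice norm_slice)

lemma inner_quat_mult_left: "inner (q * x) (q * y) = (norm q)\<^sup>2 * inner x y" for q x y :: quat
  unfolding quat_norm_sq by (simp add: inner_quat_def times_quat_def power2_eq_square algebra_simps)

lemma inner_quat_mult_right: "inner (x * q) (y * q) = (norm q)\<^sup>2 * inner x y" for q x y :: quat
  unfolding quat_norm_sq by (simp add: inner_quat_def times_quat_def power2_eq_square algebra_simps)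

text \<open>Multiplication by a unit quaternion, on either side, is an isometry. Splitting
  \<open>a = a' + (a - a')\<close> on the far left and \<open>b = (b - b') + b'\<close> on the far
  right leaves only phase differences. This substitutes for moving a phase across \<open>x\<close>,
  which noncommutativity forbids.\<close>

lemma inner_qexp_mult:
  assumes "pure_unit \<nu>" "pure_unit \<mu>"
  shows "inner (qexp \<nu> a * x * qexp \<mu> b) (qexp \<nu> a' * y * qexp \<mu> b')
       = inner (qexp \<nu> (a - a') * x * qexp \<mu> (b - b')) y"
proof -
  have "qexp \<nu> a * x * qexp \<mu> b = qexp \<nu> a' * (qexp \<nu> (a - a') * x * qexp \<mu> (b - b')) * qexp \<mu> b'"
    by (simp add: mult.assoc flip: qexp_add[OF assms(1)] qexp_add[OF assms(2)])
      (simp add: qexp_add[OF assms(1), of a' "a - a'", simplified] flip: mult.assoc)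
  then show ?thesis
    by (simp add: inner_quat_mult_left inner_quat_mult_right norm_qexp assms)
qed

section \<open>Gaussian integrals, Fubini and convolution\<close>

lemma nn_integral_lborel_affine:
  fixes f :: "'a::euclidean_space \<Rightarrow> ennreal"
  assumes [measurable]: "f \<in> borel_measurable borel" and c: "c \<noteq> 0"
  shows "(\<integral>\<^sup>+x. f x \<partial>lborel) = ennreal (\<bar>c\<bar> ^ DIM('a)) * (\<integral>\<^sup>+x. f (t + c *\<^sub>R x) \<partial>lborel)"
  by (subst lborel_affine[OF c, of t])
     (simp add: nn_integral_density nn_integral_distr nn_integral_cmult)

text \<open>These are the real and imaginary parts of the characteristic function of the normal law,
  which is real and equals \<open>sqrt (2 * pi) * std_normal_density t\<close>. Dilation by
  \<open>\<delta>\<close> turns the frequency \<open>r\<close> into \<open>r / \<delta>\<close> and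
  contributes the factor \<open>1 / \<delta>\<close>.\<close>

lemma gaussian_fourier:
  fixes \<delta> r :: real
  assumes "\<delta> > 0"
  shows "has_bochner_integral lborel (\<lambda>x. std_normal_density (\<delta> * x) * cos (r * x))
           (sqrt (2 * pi) / \<delta> * std_normal_density (r / \<delta>))"
    and "has_bochner_integral lborel (\<lambda>x. std_normal_density (\<delta> * x) * sin (r * x)) 0"
proof -
  define t where "t = r / \<delta>"
  have int: "integrable lborel (\<lambda>x. std_normal_density x *\<^sub>R iexp (t * x))"
    by (rule Bochner_Integration.integrable_bound[OF integrable_normal_density[of 1 0]])
       (auto simp: norm_exp_i_times)
  have "(LINT x|lborel. std_normal_density x *\<^sub>R iexp (t * x)) = char std_normal_distribution t"
    unfolding char_def by (subst integral_density) auto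
  also have "\<dots> = sqrt (2 * pi) * std_normal_density t"
    unfolding char_std_normal_distribution by (simp add: std_normal_density_def)
  finally have hb: "has_bochner_integral lborel (\<lambda>x. std_normal_density x *\<^sub>R iexp (t * x))
      (complex_of_real (sqrt (2 * pi) * std_normal_density t))"
    using int by (simp add: has_bochner_integral_iff)
  have re: "has_bochner_integral lborel (\<lambda>x. std_normal_density x * cos (t * x)) (sqrt (2 * pi)
      * std_normal_density t)"
    using has_bochner_integral_bounded_linear[OF bounded_linear_Re hb] by (simp add: Re_exp)
  have im: "has_bochner_integral lborel (\<lambda>x. std_normal_density x * sin (t * x)) 0"
    using has_bochner_integral_bounded_linear[OF bounded_linear_Im hb] by (simp add: Im_exp)
  show "has_bochner_integral lborel (\<lambda>x. std_normal_density (\<delta> * x) * cos (r * x))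
           (sqrt (2 * pi) / \<delta> * std_normal_density (r / \<delta>))"
    using re assms
    by (subst (asm) lborel_has_bochner_integral_real_affine_iff[where c=\<delta> and t=0])
       (auto simp: t_def field_simps)
  show "has_bochner_integral lborel (\<lambda>x. std_normal_density (\<delta> * x) * sin (r * x)) 0"
    using im assms
    by (subst (asm) lborel_has_bochner_integral_real_affine_iff[where c=\<delta> and t=0])
       (auto simp: t_def field_simps)
qed

lemma has_bochner_integral_lborel_prod:
  fixes f :: "'a::euclidean_space \<Rightarrow> real" and g :: "'b::euclidean_space \<Rightarrow> real"
  assumes f: "has_bochner_integral lborel f a" and g: "has_bochner_integral lborel g b"
  shows "has_bochner_integral lborel (\<lambda>u. f (fst u) * g (snd u)) (a * b)"
proof -
  have [measurable]: "f \<in> borel_measurable borel" "g \<in> borel_measurable borel"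
    using f g by (auto simp: has_bochner_integral_iff dest: borel_measurable_integrable)
  have int: "integrable (lborel \<Otimes>\<^sub>M lborel) (\<lambda>u. f (fst u) * g (snd u))"
    using f g by (intro lborel_pair.Fubini_integrable) (auto simp: has_bochner_integral_iff abs_mult)
  show ?thesis
    using lborel_pair.integral_fst'[OF int] int f g by (simp add: lborel_prod has_bochner_integral_iff)
qed

lemma borel_measurable_qexp [measurable]: "qexp \<nu> \<in> borel_measurable borel"
  unfolding qexp_def by measurable

lemma borel_measurable_fst_borel [measurable (raw)]:
  fixes f :: "'c \<Rightarrow> 'a::second_countable_topology \<times> 'b::second_countable_topology"
  shows "f \<in> borel_measurable M \<Longrightarrow> (\<lambda>x. fst (f x)) \<in> borel_measurable M"
  unfolding borel_prod[symmetric] by simp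

lemma borel_measurable_snd_borel [measurable (raw)]:
  fixes f :: "'c \<Rightarrow> 'a::second_countable_topology \<times> 'b::second_countable_topology"
  shows "f \<in> borel_measurable M \<Longrightarrow> (\<lambda>x. snd (f x)) \<in> borel_measurable M"
  unfolding borel_prod[symmetric] by simp

text \<open>Evaluates the \<open>u\<close>-integral in \<open>gaussian_bessel\<close>, where
  \<open>r1\<close> and \<open>r2\<close> are multiples of the coordinate differences of two points.
  A wide weight (small \<open>\<delta>\<close>) yields a narrow Gaussian in those
  differences.\<close>

lemma gaussian_correlation:
  fixes r1 r2 \<delta> :: real
  assumes \<delta>: "\<delta> > 0"
  shows "(LINT u|lborel. std_normal_density (\<delta> * fst u) * std_normal_density (\<delta> * snd u) *
           inner (qexp \<nu> (r1 * fst u) * x * qexp \<mu> (r2 * snd u)) y)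
    = 2 * pi / \<delta>\<^sup>2 * (std_normal_density (r1 / \<delta>) * std_normal_density (r2 / \<delta>)) * inner x y"
proof -
  note G = gaussian_fourier[OF \<delta>]
  let ?c = "\<lambda>r x. std_normal_density (\<delta> * x) * cos (r * x)"
  let ?s = "\<lambda>r x. std_normal_density (\<delta> * x) * sin (r * x)"
  note H = has_bochner_integral_mult_left[OF has_bochner_integral_lborel_prod]
  \<comment> \<open>The sine terms integrate to zero, which makes the two-sided kernel collapse to a scalar.\<close>
  have "has_bochner_integral lborel (\<lambda>u. ?c r1 (fst u) * ?c r2 (snd u) * inner x y
      + ?s r1 (fst u) * ?c r2 (snd u) * inner (\<nu> * x) y
      + (?c r1 (fst u) * ?s r2 (snd u) * inner (x * \<mu>) y
      + ?s r1 (fst u) * ?s r2 (snd u) * inner (\<nu> * x * \<mu>) y))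
     ((sqrt (2 * pi) / \<delta> * std_normal_density (r1 / \<delta>)) * (sqrt (2 * pi) / \<delta>
         * std_normal_density (r2 / \<delta>)) * inner x y
     + 0 * (sqrt (2 * pi) / \<delta> * std_normal_density (r2 / \<delta>)) * inner (\<nu> * x) y
     + ((sqrt (2 * pi) / \<delta> * std_normal_density (r1 / \<delta>)) * 0 * inner (x * \<mu>) y
     + 0 * 0 * inner (\<nu> * x * \<mu>) y))"
    by (intro has_bochner_integral_add H G)
  also have "(\<lambda>u. ?c r1 (fst u) * ?c r2 (snd u) * inner x y
      + ?s r1 (fst u) * ?c r2 (snd u) * inner (\<nu> * x) y
      + (?c r1 (fst u) * ?s r2 (snd u) * inner (x * \<mu>) y
      + ?s r1 (fst u) * ?s r2 (snd u) * inner (\<nu> * x * \<mu>) y))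
    = (\<lambda>u. std_normal_density (\<delta> * fst u) * std_normal_density (\<delta> * snd u) *
           inner (qexp \<nu> (r1 * fst u) * x * qexp \<mu> (r2 * snd u)) y)"
    unfolding qexp_def by (simp add: algebra_simps inner_add_left of_real_def)
  finally show ?thesis
    using \<delta> by (simp add: has_bochner_integral_integral_eq power2_eq_square field_simps)
qed

lemma nn_integral_lborel_prod':
  fixes f :: "'a::euclidean_space \<times> 'b::euclidean_space \<Rightarrow> ennreal"
  assumes "f \<in> borel_measurable borel"
  shows "(\<integral>\<^sup>+z. f z \<partial>lborel) = (\<integral>\<^sup>+x. \<integral>\<^sup>+y. f (x, y) \<partial>lborel \<partial>lborel)"
    and "(\<integral>\<^sup>+z. f z \<partial>lborel) = (\<integral>\<^sup>+y. \<integral>\<^sup>+x. f (x, y) \<partial>lborel \<partial>lborel)"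
proof -
  have f: "f \<in> borel_measurable (lborel \<Otimes>\<^sub>M lborel)"
    using assms by (simp add: lborel_prod)
  show "(\<integral>\<^sup>+z. f z \<partial>lborel) = (\<integral>\<^sup>+x. \<integral>\<^sup>+y. f (x, y) \<partial>lborel \<partial>lborel)"
    using lborel.nn_integral_fst[OF f] by (simp add: lborel_prod)
  show "(\<integral>\<^sup>+z. f z \<partial>lborel) = (\<integral>\<^sup>+y. \<integral>\<^sup>+x. f (x, y) \<partial>lborel \<partial>lborel)"
    using lborel_pair.nn_integral_snd[OF f] by (simp add: lborel_prod)
qed

lemma nn_integral_std_normal_density:
  assumes "c \<noteq> 0"
  shows "(\<integral>\<^sup>+x. ennreal (std_normal_density (c * x)) \<partial>lborel) = ennreal (1 / \<bar>c\<bar>)"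
proof -
  have "1 = (\<integral>\<^sup>+x. ennreal (std_normal_density x) \<partial>lborel)"
    by (subst nn_integral_eq_integral) auto
  also have "\<dots> = ennreal \<bar>c\<bar> * (\<integral>\<^sup>+x. ennreal (std_normal_density (c * x)) \<partial>lborel)"
    by (subst nn_integral_real_affine[OF _ assms, where t=0]) auto
  finally have *: "ennreal \<bar>c\<bar> * (\<integral>\<^sup>+x. ennreal (std_normal_density (c * x)) \<partial>lborel) = 1" ..
  have "(\<integral>\<^sup>+x. ennreal (std_normal_density (c * x)) \<partial>lborel)
    = ennreal (1 / \<bar>c\<bar>) * (ennreal \<bar>c\<bar> * (\<integral>\<^sup>+x. ennreal (std_normal_density (c * x)) \<partial>lborel))"
    using assms by (simp flip: mult.assoc ennreal_mult)
  then show ?thesis by (simp add: *)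
qed

text \<open>Lebesgue measure is invariant under translation and reflection, so integrating
  \<open>P (x - y)\<close> over either variable gives the full mass of \<open>P\<close>. The
  symmetric sum is the form produced by AM-GM.\<close>

lemma nn_integral_symmetric_convolution:
  fixes N P :: "'a::euclidean_space \<Rightarrow> ennreal"
  assumes [measurable]: "N \<in> borel_measurable borel" "P \<in> borel_measurable borel"
  shows "(\<integral>\<^sup>+z. (N (fst z) + N (snd z)) * P (fst z - snd z) \<partial>lborel)
    = 2 * ((\<integral>\<^sup>+x. N x \<partial>lborel) * (\<integral>\<^sup>+x. P x \<partial>lborel))"
proof -
  have 1: "(\<integral>\<^sup>+y. P (x - y) \<partial>lborel) = (\<integral>\<^sup>+x. P x \<partial>lborel)" for x
    using nn_integral_lborel_affine[of P "-1" x] by simp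
  have 2: "(\<integral>\<^sup>+x. P (x - y) \<partial>lborel) = (\<integral>\<^sup>+x. P x \<partial>lborel)" for y
    using nn_integral_lborel_affine[of P 1 "- y"] by simp
  have "(\<integral>\<^sup>+z. (N (fst z) + N (snd z)) * P (fst z - snd z) \<partial>lborel)
    = (\<integral>\<^sup>+z. N (fst z) * P (fst z - snd z) \<partial>lborel) + (\<integral>\<^sup>+z. N (snd z) * P (fst z - snd z) \<partial>lborel)"
    unfolding distrib_right by (intro nn_integral_add) measurable
  also have "(\<integral>\<^sup>+z. N (fst z) * P (fst z - snd z) \<partial>lborel) = (\<integral>\<^sup>+x. N x \<partial>lborel) * (\<integral>\<^sup>+x. P x \<partial>lborel)"
    by (subst nn_integral_lborel_prod'(1)) (simp_all add: nn_integral_cmult nn_integral_multc 1)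
  also have "(\<integral>\<^sup>+z. N (snd z) * P (fst z - snd z) \<partial>lborel) = (\<integral>\<^sup>+x. N x \<partial>lborel) * (\<integral>\<^sup>+x. P x \<partial>lborel)"
    by (subst nn_integral_lborel_prod'(2)) (simp_all add: nn_integral_cmult nn_integral_multc 2)
  finally show ?thesis by (simp add: mult_2)
qed

section \<open>Plancherel inequality for the two-sided quaternionic Fourier transform\<close>

text \<open>The bound is uniform in \<open>\<delta>\<close>: the factor
  \<open>2 * pi / \<delta>\<^sup>2\<close> from the Gaussian correlation cancels against the mass
  \<open>\<delta>\<^sup>2 / \<bar>\<kappa>1 * \<kappa>2\<bar>\<close> of the narrow Gaussian. That
  uniformity permits the limit in \<open>quat_fourier_bessel\<close>.\<close>

lemma gaussian_bessel:
  fixes h :: "real \<times> real \<Rightarrow> quat" and \<delta> \<kappa>1 \<kappa>2 :: real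
  assumes h: "integrable lborel h" and pu: "pure_unit \<nu>" "pure_unit \<mu>"
    and \<kappa>: "\<kappa>1 \<noteq> 0" "\<kappa>2 \<noteq> 0" and \<delta>: "\<delta> > 0"
  shows "(\<integral>\<^sup>+u. ennreal (std_normal_density (\<delta> * fst u) * std_normal_density (\<delta> * snd u) *
      (norm (LINT s|lborel. qexp \<nu> (\<kappa>1 * fst s * fst u) * h s * qexp \<mu> (\<kappa>2 * snd s
          * snd u)))\<^sup>2) \<partial>lborel)
    \<le> ennreal (2 * pi / \<bar>\<kappa>1 * \<kappa>2\<bar>) * (\<integral>\<^sup>+s. ennreal ((norm (h s))\<^sup>2) \<partial>lborel)"
proof -
  have [measurable]: "h \<in> borel_measurable borel"
    using h by (auto dest: borel_measurable_integrable)
  define F where "F u s = qexp \<nu> (\<kappa>1 * fst s * fst u) * h s * qexp \<mu> (\<kappa>2 * snd s * snd u)" for u s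
  have [measurable]: "F u \<in> borel_measurable borel" for u
    unfolding F_def by measurable
  have norm_F: "norm (F u s) = norm (h s)" for u s
    by (simp add: F_def norm_mult norm_qexp pu)
  have int_F: "integrable lborel (F u)" for u
    by (rule Bochner_Integration.integrable_bound[OF h]) (auto simp: norm_F)
  define T where "T u = (LINT s|lborel. F u s)" for u
  define w where "w u = std_normal_density (\<delta> * fst u) * std_normal_density (\<delta> * snd u)" for u
  have w_nonneg: "w u \<ge> 0" for u by (simp add: w_def)
  have [measurable]: "w \<in> borel_measurable borel" unfolding w_def by measurable
  \<comment> \<open>At frequency 0 the cosine is 1, so \<open>gaussian_fourier\<close> yields
    integrability of the bare weight.\<close>
  have w: "integrable lborel w"
    using has_bochner_integral_lborel_prod[OF gaussian_fourier(1)[OF \<delta>, of 0]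
        gaussian_fourier(1)[OF \<delta>, of 0]]
    by (simp add: w_def[abs_def] has_bochner_integral_iff)
  have nh: "integrable lborel (\<lambda>s. norm (h s))" using h by simp
  have hh: "integrable lborel (\<lambda>z. norm (h (fst z)) * norm (h (snd z)))"
    using has_bochner_integral_lborel_prod[OF has_bochner_integral_integrable[OF nh]
        has_bochner_integral_integrable[OF nh]]
    by (simp add: has_bochner_integral_iff)
  have int_FF: "integrable lborel (\<lambda>z. inner (F u (fst z)) (F u (snd z)))" for u
    by (rule Bochner_Integration.integrable_bound[OF hh])
       (auto simp: norm_F intro!: AE_I2 order_trans[OF Cauchy_Schwarz_ineq2])
  \<comment> \<open>The inner product is bilinear and bounded, so the two integrals in
    \<open>inner (T u) (T u)\<close> can be pulled out one after the other.\<close>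
  have norm_T: "(norm (T u))\<^sup>2 = (LINT z|lborel. inner (F u (fst z)) (F u (snd z)))" for u
  proof -
    have "(LINT z|lborel. inner (F u (fst z)) (F u (snd z)))
      = (LINT x|lborel. LINT y|lborel. inner (F u x) (F u y))"
      using lborel_pair.integral_fst'[of "\<lambda>z. inner (F u (fst z)) (F u (snd z))"] int_FF[of u]
      by (simp add: lborel_prod)
    also have "\<dots> = (LINT x|lborel. inner (F u x) (T u))"
      by (simp add: T_def int_F)
    also have "\<dots> = inner (T u) (T u)"
      by (simp add: T_def int_F)
    finally show ?thesis by (simp add: power2_norm_eq_inner)
  qed
  define B where "B u z = w u * inner (F u (fst z)) (F u (snd z))" for u z
  have B_norm: "norm (B u z) \<le> w u * (norm (h (fst z)) * norm (h (snd z)))" for u z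
    unfolding B_def real_norm_def abs_mult abs_of_nonneg[OF w_nonneg]
    by (intro mult_left_mono w_nonneg order_trans[OF Cauchy_Schwarz_ineq2]) (simp add: norm_F)
  have [measurable]: "(\<lambda>v. B (fst v) (snd v)) \<in> borel_measurable borel"
    unfolding B_def F_def by measurable
  \<comment> \<open>The weight supplies integrability in \<open>u\<close>, and \<open>h\<close>
    being integrable supplies it in both points; this justifies exchanging the order of
    integration.\<close>
  have int_B: "integrable lborel (\<lambda>v. B (fst v) (snd v))"
  proof (rule Bochner_Integration.integrable_bound)
    show "integrable lborel (\<lambda>v. w (fst v) * (norm (h (fst (snd v))) * norm (h (snd (snd v)))))"
      using has_bochner_integral_lborel_prod[OF has_bochner_integral_integrable[OF w]
          has_bochner_integral_integrable[OF hh]]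
      by (simp add: has_bochner_integral_iff)
    show "AE v in lborel. norm (B (fst v) (snd v))
        \<le> norm (w (fst v) * (norm (h (fst (snd v))) * norm (h (snd (snd v)))))"
      by (intro AE_I2 order_trans[OF B_norm]) auto
  qed auto
  have int_B': "integrable (lborel \<Otimes>\<^sub>M lborel) (case_prod B)"
    using int_B by (simp add: lborel_prod case_prod_unfold)
  define Q where "Q s = std_normal_density (\<kappa>1 / \<delta> * fst s) * std_normal_density (\<kappa>2 / \<delta>
      * snd s)" for s :: "real \<times> real"
  have Q_nonneg: "Q s \<ge> 0" for s by (simp add: Q_def)
  have [measurable]: "Q \<in> borel_measurable borel" unfolding Q_def by measurable
  have Q: "(\<integral>\<^sup>+s. ennreal (Q s) \<partial>lborel) = ennreal (\<delta>\<^sup>2 / \<bar>\<kappa>1 * \<kappa>2\<bar>)"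
  proof -
    have "(\<integral>\<^sup>+s. ennreal (Q s) \<partial>lborel) = (\<integral>\<^sup>+x. \<integral>\<^sup>+y. ennreal (std_normal_density (\<kappa>1 / \<delta> * x))
        * ennreal (std_normal_density (\<kappa>2 / \<delta> * y)) \<partial>lborel \<partial>lborel)"
      by (subst nn_integral_lborel_prod'(1)) (simp_all add: Q_def ennreal_mult)
    also have "\<dots> = ennreal (1 / \<bar>\<kappa>1 / \<delta>\<bar>) * ennreal (1 / \<bar>\<kappa>2 / \<delta>\<bar>)"
      using \<kappa> \<delta> nn_integral_std_normal_density[of "\<kappa>1 / \<delta>"] nn_integral_std_normal_density[of "\<kappa>2 / \<delta>"]
      by (simp add: nn_integral_cmult nn_integral_multc)
    also have "\<dots> = ennreal (\<delta>\<^sup>2 / \<bar>\<kappa>1 * \<kappa>2\<bar>)"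
      using \<delta> by (simp add: power2_eq_square abs_mult flip: ennreal_mult)
    finally show ?thesis .
  qed
  \<comment> \<open>Only the phase differences survive in \<open>B\<close>, so its
    \<open>u\<close>-integral is a real multiple of \<open>inner (h (fst z)) (h (snd z))\<close>,
    with a weight depending on \<open>fst z - snd z\<close> alone.\<close>
  have B_int: "(LINT u|lborel. B u z) = 2 * pi / \<delta>\<^sup>2 * Q (fst z - snd z)
      * inner (h (fst z)) (h (snd z))" for z
  proof -
    have "B u z = std_normal_density (\<delta> * fst u) * std_normal_density (\<delta> * snd u) *
       inner (qexp \<nu> (\<kappa>1 * (fst (fst z) - fst (snd z)) * fst u) * h (fst z) *
         qexp \<mu> (\<kappa>2 * (snd (fst z) - snd (snd z)) * snd u)) (h (snd z))" for u
      by (simp add: B_def w_def F_def inner_qexp_mult[OF pu] left_diff_distrib right_diff_distrib)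
    then show ?thesis
      using gaussian_correlation[OF \<delta>, of \<nu> "\<kappa>1 * (fst (fst z) - fst (snd z))" "h (fst z)" \<mu>
        "\<kappa>2 * (snd (fst z) - snd (snd z))" "h (snd z)"]
      by (simp add: Q_def)
  qed
  have T2: "w u * (norm (T u))\<^sup>2 = (LINT z|lborel. B u z)" for u
    by (simp add: norm_T B_def)
  have int_wT: "integrable lborel (\<lambda>u. w u * (norm (T u))\<^sup>2)"
    unfolding T2 using lborel_pair.integrable_fst[OF int_B'] by simp
  have "(\<integral>\<^sup>+u. ennreal (w u * (norm (T u))\<^sup>2) \<partial>lborel) = ennreal (LINT u|lborel. w u * (norm (T u))\<^sup>2)"
    by (rule nn_integral_eq_integral[OF int_wT]) (simp add: w_nonneg)
  also have "(LINT u|lborel. w u * (norm (T u))\<^sup>2) = (LINT z|lborel. LINT u|lborel. B u z)"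
    unfolding T2 using lborel_pair.Fubini_integral[OF int_B'] by simp
  also have "ennreal \<dots> \<le> ennreal (norm \<dots>)" by (intro ennreal_leI) simp
  also have "\<dots> \<le> (\<integral>\<^sup>+z. ennreal (norm (LINT u|lborel. B u z)) \<partial>lborel)"
    using lborel_pair.integrable_snd[OF int_B'] by (intro integral_norm_bound_ennreal) simp
  \<comment> \<open>Cauchy-Schwarz and AM-GM replace the inner product by half the sum of the
    squared norms; the half turns \<open>2 * pi\<close> into \<open>pi\<close>.\<close>
  also have "\<dots> \<le> (\<integral>\<^sup>+z. ennreal (pi / \<delta>\<^sup>2) * ((ennreal ((norm (h (fst z)))\<^sup>2)
      + ennreal ((norm (h (snd z)))\<^sup>2)) * ennreal (Q (fst z - snd z))) \<partial>lborel)"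
  proof (intro nn_integral_mono)
    fix z :: "(real \<times> real) \<times> (real \<times> real)"
    have "\<bar>inner (h (fst z)) (h (snd z))\<bar> \<le> norm (h (fst z)) * norm (h (snd z))"
      by (rule Cauchy_Schwarz_ineq2)
    also have "\<dots> \<le> ((norm (h (fst z)))\<^sup>2 + (norm (h (snd z)))\<^sup>2) / 2"
      using sum_squares_bound[of "norm (h (fst z))" "norm (h (snd z))"] by simp
    finally have "norm (LINT u|lborel. B u z) \<le> 2 * pi / \<delta>\<^sup>2 * Q (fst z - snd z)
        * (((norm (h (fst z)))\<^sup>2 + (norm (h (snd z)))\<^sup>2) / 2)"
      unfolding B_int real_norm_def abs_mult by (intro mult_mono) (auto simp: Q_nonneg)
    also have "\<dots> = pi / \<delta>\<^sup>2 * (((norm (h (fst z)))\<^sup>2 + (norm (h (snd z)))\<^sup>2) * Q (fst z - snd z))"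
      by simp
    finally show "ennreal (norm (LINT u|lborel. B u z))
        \<le> ennreal (pi / \<delta>\<^sup>2) * ((ennreal ((norm (h (fst z)))\<^sup>2) + ennreal ((norm (h (snd z)))\<^sup>2))
            * ennreal (Q (fst z - snd z)))"
      by (simp add: Q_nonneg ennreal_leI flip: ennreal_mult ennreal_plus)
  qed
  also have "\<dots> = ennreal (pi / \<delta>\<^sup>2) * (2 * ((\<integral>\<^sup>+s. ennreal ((norm (h s))\<^sup>2) \<partial>lborel)
      * ennreal (\<delta>\<^sup>2 / \<bar>\<kappa>1 * \<kappa>2\<bar>)))"
    by (subst nn_integral_cmult) (simp_all add: nn_integral_symmetric_convolution[of
        "\<lambda>s. ennreal ((norm (h s))\<^sup>2)" "\<lambda>s. ennreal (Q s)"] Q)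
  also have "\<dots> = ennreal (pi / \<delta>\<^sup>2) * ennreal 2 * ennreal (\<delta>\<^sup>2 / \<bar>\<kappa>1 * \<kappa>2\<bar>) *
      (\<integral>\<^sup>+s. ennreal ((norm (h s))\<^sup>2) \<partial>lborel)"
    by (simp add: mult_ac)
  also have "ennreal (pi / \<delta>\<^sup>2) * ennreal 2 * ennreal (\<delta>\<^sup>2 / \<bar>\<kappa>1 * \<kappa>2\<bar>) = ennreal (2 * pi / \<bar>\<kappa>1 * \<kappa>2\<bar>)"
    using \<delta> by (subst ennreal_mult[symmetric], simp, simp)+ simp
  finally show ?thesis unfolding w_def T_def F_def .
qed

lemma quat_fourier_bessel:
  fixes h :: "real \<times> real \<Rightarrow> quat" and \<kappa>1 \<kappa>2 :: real
  assumes h: "integrable lborel h" and pu: "pure_unit \<nu>" "pure_unit \<mu>"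
    and \<kappa>: "\<kappa>1 \<noteq> 0" "\<kappa>2 \<noteq> 0"
  shows "(\<integral>\<^sup>+u. ennreal
      ((norm (LINT s|lborel. qexp \<nu> (\<kappa>1 * fst s * fst u) * h s * qexp \<mu> (\<kappa>2 * snd s
          * snd u)))\<^sup>2) \<partial>lborel)
    \<le> ennreal ((2 * pi)\<^sup>2 / \<bar>\<kappa>1 * \<kappa>2\<bar>) * (\<integral>\<^sup>+s. ennreal ((norm (h s))\<^sup>2) \<partial>lborel)"
proof -
  have [measurable]: "h \<in> borel_measurable borel"
    using h by (auto dest: borel_measurable_integrable)
  define T where "T u = (LINT s|lborel. qexp \<nu> (\<kappa>1 * fst s * fst u) * h s * qexp \<mu> (\<kappa>2 * snd s
      * snd u))" for u
  have [measurable]: "T \<in> borel_measurable borel"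
    unfolding T_def by measurable
  let ?d = "\<lambda>n. 1 / real (Suc n)"
  define w where "w n u = std_normal_density (?d n * fst u) * std_normal_density (?d n * snd u)" for n u
  have [measurable]: "w n \<in> borel_measurable borel" for n unfolding w_def by measurable
  let ?I = "\<integral>\<^sup>+s. ennreal ((norm (h s))\<^sup>2) \<partial>lborel"
  \<comment> \<open>The standard normal density is \<open>1 / sqrt (2 * pi)\<close> at 0, so the
    planar weight tends to \<open>1 / (2 * pi)\<close> pointwise; the factor \<open>2 * pi\<close>
    normalises this limit to 1. It also accounts for the second \<open>2 * pi\<close> in the final
    constant.\<close>
  have lim: "(\<lambda>n. ennreal (2 * pi * (w n u * (norm (T u))\<^sup>2))) \<longlonglongrightarrow> ennreal ((norm (T u))\<^sup>2)" for u
  proof -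
    have d: "?d \<longlonglongrightarrow> 0" by (rule LIMSEQ_Suc) (rule lim_1_over_n)
    have "(\<lambda>n. std_normal_density (?d n * x)) \<longlonglongrightarrow> std_normal_density (0 * x)" for x
      unfolding std_normal_density_def by (intro tendsto_intros d) simp_all
    then have "(\<lambda>n. 2 * pi * (w n u * (norm (T u))\<^sup>2)) \<longlonglongrightarrow>
       2 * pi * (std_normal_density (0 * fst u) * std_normal_density (0 * snd u) * (norm (T u))\<^sup>2)"
      unfolding w_def by (intro tendsto_intros)
    also have "2 * pi * (std_normal_density (0 * fst u) * std_normal_density (0 * snd u)
        * (norm (T u))\<^sup>2) = (norm (T u))\<^sup>2"
      by (simp add: std_normal_density_def)
    finally show ?thesis by (rule tendsto_ennrealI)
  qed
  have "(\<integral>\<^sup>+u. ennreal ((norm (T u))\<^sup>2) \<partial>lborel)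
    = (\<integral>\<^sup>+u. liminf (\<lambda>n. ennreal (2 * pi * (w n u * (norm (T u))\<^sup>2))) \<partial>lborel)"
    by (intro nn_integral_cong) (simp add: lim_imp_Liminf[OF _ lim])
  also have "\<dots> \<le> liminf (\<lambda>n. \<integral>\<^sup>+u. ennreal (2 * pi * (w n u * (norm (T u))\<^sup>2)) \<partial>lborel)"
    by (intro nn_integral_liminf) measurable
  also have "\<dots> \<le> liminf (\<lambda>n::nat. ennreal (2 * pi) * (ennreal (2 * pi / \<bar>\<kappa>1 * \<kappa>2\<bar>) * ?I))"
  proof (intro Liminf_mono always_eventually allI)
    fix n
    have "(\<integral>\<^sup>+u. ennreal (2 * pi * (w n u * (norm (T u))\<^sup>2)) \<partial>lborel)
      = ennreal (2 * pi) * (\<integral>\<^sup>+u. ennreal (w n u * (norm (T u))\<^sup>2) \<partial>lborel)"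
      by (simp add: ennreal_mult' nn_integral_cmult w_def)
    also have "\<dots> \<le> ennreal (2 * pi) * (ennreal (2 * pi / \<bar>\<kappa>1 * \<kappa>2\<bar>) * ?I)"
      unfolding w_def T_def by (intro mult_left_mono gaussian_bessel assms) auto
    finally show "(\<integral>\<^sup>+u. ennreal (2 * pi * (w n u * (norm (T u))\<^sup>2)) \<partial>lborel)
      \<le> ennreal (2 * pi) * (ennreal (2 * pi / \<bar>\<kappa>1 * \<kappa>2\<bar>) * ?I)" .
  qed
  also have "\<dots> = ennreal ((2 * pi)\<^sup>2 / \<bar>\<kappa>1 * \<kappa>2\<bar>) * ?I"
    by (simp add: Liminf_const power2_eq_square flip: mult.assoc ennreal_mult)
  finally show ?thesis unfolding T_def .
qed

section \<open>Borel representatives of Lebesgue measurable functions\<close>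

text \<open>The affine change of variables, applied to the indicator of a null set, shows that its
  preimage is null. For each fixed \<open>t\<close> this allows \<open>f\<close> and
  \<open>g\<close> to be replaced by representatives at the points \<open>t + s /\<^sub>R 2\<close>
  and \<open>t - s /\<^sub>R 2\<close>.\<close>

lemma AE_lborel_affine:
  fixes t :: "'a::euclidean_space"
  assumes "AE x in lborel. P x" and c: "c \<noteq> 0"
  shows "AE x in lborel. P (t + c *\<^sub>R x)"
proof -
  from assms(1) obtain N where N: "N \<in> null_sets lborel" "{x. \<not> P x} \<subseteq> N"
    by (auto simp: eventually_ae_filter)
  then have [measurable]: "N \<in> sets borel" by auto
  have "0 = (\<integral>\<^sup>+x. indicator N x \<partial>lborel)" using N(1) by (simp add: null_setsD1)
  also have "\<dots> = ennreal (\<bar>c\<bar> ^ DIM('a)) * (\<integral>\<^sup>+x. indicator N (t + c *\<^sub>R x) \<partial>lborel)"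
    by (rule nn_integral_lborel_affine[OF _ c]) simp
  finally have "(\<integral>\<^sup>+x. indicator N (t + c *\<^sub>R x) \<partial>lborel) = 0"
    using c by auto
  then have "AE x in lborel. indicator N (t + c *\<^sub>R x) = (0::ennreal)"
    by (subst (asm) nn_integral_0_iff_AE) auto
  then show ?thesis
    by eventually_elim (use N(2) in \<open>auto simp: indicator_def split: if_splits\<close>)
qed

text \<open>The real-valued case is applied to each coordinate; the basis is finite, so the
  exceptional null sets can be united.\<close>

lemma lebesgue_measurable_ex_borel:
  fixes f :: "'a::euclidean_space \<Rightarrow> 'b::euclidean_space"
  assumes f: "f \<in> borel_measurable lebesgue"
  obtains g where "g \<in> borel_measurable borel" "AE x in lborel. f x = g x"
proof -
  have "\<exists>g\<in>borel_measurable lborel. AE x in lborel. inner (f x) i = g x" for i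
    using f by (intro completion_ex_borel_measurable_real borel_measurable_inner) simp_all
  then obtain g where g: "g i \<in> borel_measurable lborel" "AE x in lborel. inner (f x) i = g i x" for i
    by metis
  have "AE x in lborel. \<forall>i\<in>Basis. inner (f x) i = g i x"
    using g(2) by (simp add: AE_finite_all)
  then have "AE x in lborel. f x = (\<Sum>i\<in>Basis. g i x *\<^sub>R i)"
    by eventually_elim (metis (no_types, lifting) euclidean_representation sum.cong)
  moreover have "(\<lambda>x. \<Sum>i\<in>Basis. g i x *\<^sub>R i) \<in> borel_measurable borel"
    using g(1) by simp
  ultimately show thesis using that by blast
qed

text \<open>Completeness of Lebesgue measure makes \<open>f\<close> measurable from almost
  everywhere agreement with \<open>g\<close>. This carries the integral defining the distribution
  over to \<open>lborel\<close>.\<close>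

lemma integral_lebesgue_cong_borel:
  fixes f g :: "'a::euclidean_space \<Rightarrow> 'b::euclidean_space"
  assumes g: "g \<in> borel_measurable borel" and eq: "AE x in lborel. f x = g x"
  shows "integral\<^sup>L lebesgue f = integral\<^sup>L lborel g"
proof -
  have g': "g \<in> borel_measurable lebesgue" using g by (simp add: measurable_completion)
  have f': "f \<in> borel_measurable lebesgue"
    using eq by (intro borel_measurable_AE[OF g'] AE_completion) (auto elim: eventually_mono)
  have "integral\<^sup>L lebesgue f = integral\<^sup>L lebesgue g"
    by (intro integral_cong_AE f' g' AE_completion eq)
  also have "\<dots> = integral\<^sup>L lborel g" using g by (intro integral_completion) simp
  finally show ?thesis .
qed

text \<open>Fubini is applied to \<open>lborel\<close>, whose products are again
  \<open>lborel\<close>, hence the passage to Borel representatives. The norm is kept as a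
  nonnegative integral to match the later estimates.\<close>

lemma L2_space_borel:
  assumes "f \<in> L2_space"
  obtains g where "g \<in> borel_measurable borel" "AE x in lborel. f x = g x"
    "(\<integral>\<^sup>+x. ennreal ((norm (g x))\<^sup>2) \<partial>lborel) = ennreal ((L2_norm f)\<^sup>2)"
proof -
  from assms have f: "f \<in> borel_measurable lebesgue" "integrable lebesgue (\<lambda>t. (norm (f t))\<^sup>2)"
    by (auto simp: L2_space_def)
  obtain g where g: "g \<in> borel_measurable borel" "AE x in lborel. f x = g x"
    using lebesgue_measurable_ex_borel[OF f(1)] .
  have "(\<integral>\<^sup>+x. ennreal ((norm (g x))\<^sup>2) \<partial>lborel) = (\<integral>\<^sup>+x. ennreal ((norm (f x))\<^sup>2) \<partial>lborel)"
    using g(2) by (intro nn_integral_cong_AE) (auto elim: eventually_mono)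
  also have "\<dots> = (\<integral>\<^sup>+x. ennreal ((norm (f x))\<^sup>2) \<partial>lebesgue)"
    by (simp add: nn_integral_completion)
  also have "\<dots> = ennreal ((L2_norm f)\<^sup>2)"
    using f(2) by (simp add: nn_integral_eq_integral L2_norm_def)
  finally show thesis using that g by blast
qed

section \<open>Conjugation and factorisation of the kernel\<close>

lemma borel_measurable_qcnj [measurable]: "qcnj \<in> borel_measurable borel"
proof -
  have "linear qcnj"
    by (rule linearI) (simp_all add: qcnj_def quat_ring_defs scaleR_quat_def)
  then show ?thesis
    by (intro borel_measurable_continuous_onI linear_continuous_on linear_conv_bounded_linear[THEN
        iffD1])
qed

lemma norm_qcnj [simp]: "norm (qcnj q) = norm q"
  by (simp add: norm_quat_def qcnj_def)

lemma norm_slice_prefactor: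
  assumes "pure_unit \<nu>"
  shows "norm (slice \<nu> (1 / csqrt (\<i> * 2 * pi * b))) = 1 / sqrt (2 * pi * \<bar>b\<bar>)"
  by (simp add: norm_slice[OF assms] norm_divide norm_mult)

text \<open>The factor \<open>p y\<close> has constant modulus and comes out of the integral, and the chirp \<open>ch x\<close> can be
  absorbed into the transformed function; both forms are needed because the kernel acts from the left
  for the first variable and from the right for the second.\<close>

lemma olct_kernel_split:
  fixes a b d \<tau> \<eta> :: real
  assumes "pure_unit \<nu>" "b \<noteq> 0"
  obtains p :: "real \<Rightarrow> quat" and ch :: "real \<Rightarrow> real" where
    "\<And>y. norm (p y) = 1 / sqrt (2 * pi * \<bar>b\<bar>)" "ch \<in> borel_measurable borel"
    "\<And>x y. olct_kernel \<nu> (a, b, c, d, \<tau>, \<eta>) x y = p y * (qexp \<nu> ((- 1 / b) * x * y) * qexp \<nu> (ch x))"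
    "\<And>x y. olct_kernel \<nu> (a, b, c, d, \<tau>, \<eta>) x y = qexp \<nu> (ch x) * qexp \<nu> ((- 1 / b) * x * y) * p y"
proof
  define pre where "pre = 1 / csqrt (\<i> * 2 * pi * b)"
  \<comment> \<open>The exponent is sorted into terms in \<open>y\<close> alone (\<open>ph\<close>),
    terms in \<open>x\<close> alone (\<open>ch\<close>), and the Fourier cross term
    \<open>- x * y / b\<close>.\<close>
  define ph where "ph y = 1 / (2 * b) * (d * (y\<^sup>2 + \<tau>\<^sup>2) - 2 * y * (d * \<tau> - b * \<eta>))" for y
  define ch where "ch x = 1 / (2 * b) * (a * x\<^sup>2 + 2 * x * \<tau>)" for x
  define p where "p y = slice \<nu> pre * qexp \<nu> (ph y)" for y
  show "norm (p y) = 1 / sqrt (2 * pi * \<bar>b\<bar>)" for y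
    using norm_slice_prefactor[OF assms(1)] by (simp add: p_def pre_def norm_mult norm_qexp assms)
  show "ch \<in> borel_measurable borel" unfolding ch_def by measurable
  \<comment> \<open>All factors lie in one slice, so they can be reordered as complex numbers; this
    makes both factorisations available.\<close>
  have ker: "olct_kernel \<nu> (a, b, c, d, \<tau>, \<eta>) x y
      = slice \<nu> (pre * cis (ph y + ((- 1 / b) * x * y + ch x)))" for x y
  proof -
    have "1 / (2 * b) * (a * x\<^sup>2 - 2 * x * (y - \<tau>) - 2 * y * (d * \<tau> - b * \<eta>) + d * (y\<^sup>2 + \<tau>\<^sup>2))
      = ph y + ((- 1 / b) * x * y + ch x)"
      using assms(2) by (simp add: ph_def ch_def field_simps)
    then show ?thesis by (simp only: olct_kernel.simps slice_mult[OF assms(1)] pre_def qexp_slice)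
  qed
  show "olct_kernel \<nu> (a, b, c, d, \<tau>, \<eta>) x y = p y * (qexp \<nu> ((- 1 / b) * x * y)
      * qexp \<nu> (ch x))" for x y
    unfolding ker p_def qexp_slice slice_mult[OF assms(1), symmetric] cis_mult[symmetric]
        by (simp only: mult_ac)
  show "olct_kernel \<nu> (a, b, c, d, \<tau>, \<eta>) x y = qexp \<nu> (ch x) * qexp \<nu> ((- 1 / b) * x * y) * p y" for x y
    unfolding ker p_def qexp_slice slice_mult[OF assms(1), symmetric] cis_mult[symmetric]
        by (simp only: mult_ac)
qed

section \<open>Estimates for the cross product of \<open>f\<close> and \<open>g\<close>\<close>

text \<open>The map sending \<open>(t, s)\<close> to
  \<open>(t + s /\<^sub>R 2, t - s /\<^sub>R 2)\<close> preserves volume. It is carried out as a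
  translation in \<open>t\<close> for fixed \<open>s\<close>, followed by a reflection in
  \<open>s\<close> for fixed \<open>t\<close>.\<close>

lemma nn_integral_product_cross:
  fixes F G :: "'a::euclidean_space \<Rightarrow> ennreal"
  assumes [measurable]: "F \<in> borel_measurable borel" "G \<in> borel_measurable borel"
  shows "(\<integral>\<^sup>+t. \<integral>\<^sup>+s. F (t + s /\<^sub>R 2) * G (t - s /\<^sub>R 2) \<partial>lborel \<partial>lborel)
    = (\<integral>\<^sup>+x. F x \<partial>lborel) * (\<integral>\<^sup>+x. G x \<partial>lborel)"
proof -
  have half: "t + (1 / 2) *\<^sub>R s - s = t - (1 / 2) *\<^sub>R s" for s t :: 'a
  proof -
    have "(1 / 2) *\<^sub>R s + (1 / 2) *\<^sub>R s = s" by (simp flip: scaleR_add_left)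
    then show ?thesis by (metis add_diff_cancel_right)
  qed
  have "(\<integral>\<^sup>+t. \<integral>\<^sup>+s. F (t + s /\<^sub>R 2) * G (t - s /\<^sub>R 2) \<partial>lborel \<partial>lborel)
    = (\<integral>\<^sup>+s. \<integral>\<^sup>+t. F (t + s /\<^sub>R 2) * G (t - s /\<^sub>R 2) \<partial>lborel \<partial>lborel)"
    by (rule lborel_pair.Fubini'[symmetric]) measurable
  also have "\<dots> = (\<integral>\<^sup>+s. \<integral>\<^sup>+t. F t * G (t - s) \<partial>lborel \<partial>lborel)"
  proof (rule nn_integral_cong)
    fix s :: 'a
    show "(\<integral>\<^sup>+t. F (t + s /\<^sub>R 2) * G (t - s /\<^sub>R 2) \<partial>lborel) = (\<integral>\<^sup>+t. F t * G (t - s) \<partial>lborel)"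
      using nn_integral_lborel_affine[of "\<lambda>t. F t * G (t - s)" 1 "(1 / 2) *\<^sub>R s"]
      by (simp add: add.commute[of "(1 / 2) *\<^sub>R s"] half)
  qed
  also have "\<dots> = (\<integral>\<^sup>+t. \<integral>\<^sup>+s. F t * G (t - s) \<partial>lborel \<partial>lborel)"
    by (rule lborel_pair.Fubini') measurable
  also have "\<dots> = (\<integral>\<^sup>+t. F t * (\<integral>\<^sup>+x. G x \<partial>lborel) \<partial>lborel)"
  proof (rule nn_integral_cong)
    fix t :: 'a
    show "(\<integral>\<^sup>+s. F t * G (t - s) \<partial>lborel) = F t * (\<integral>\<^sup>+x. G x \<partial>lborel)"
      using nn_integral_lborel_affine[of G "-1" t] by (simp add: nn_integral_cmult)
  qed
  also have "\<dots> = (\<integral>\<^sup>+x. F x \<partial>lborel) * (\<integral>\<^sup>+x. G x \<partial>lborel)"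
    by (simp add: nn_integral_multc)
  finally show ?thesis .
qed

text \<open>At \<open>x = 0\<close> both sides vanish because \<open>0 powr a = 0\<close> for every
  \<open>a\<close>, even when \<open>p = 2\<close>.\<close>

lemma powr_minus_two_mult: "x powr (p - 2) * x\<^sup>2 = x powr p" if "x \<ge> 0" for x p :: real
  using that by (cases "x = 0") (simp_all add: powr_diff)

text \<open>Cauchy-Schwarz in \<open>s\<close>. In the plane, halving \<open>s\<close> has Jacobian
  1/4, so each squared norm acquires a factor 4 and the bound becomes \<open>4 * F * G\<close>,
  uniformly in \<open>t\<close>.\<close>

lemma cross_product_integral_bound:
  fixes f g :: "real \<times> real \<Rightarrow> quat"
  assumes [measurable]: "f \<in> borel_measurable borel" "g \<in> borel_measurable borel"
    and f: "(\<integral>\<^sup>+x. ennreal ((norm (f x))\<^sup>2) \<partial>lborel) = ennreal (F\<^sup>2)" and F: "F \<ge> 0"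
    and g: "(\<integral>\<^sup>+x. ennreal ((norm (g x))\<^sup>2) \<partial>lborel) = ennreal (G\<^sup>2)" and G: "G \<ge> 0"
  shows "integrable lborel (\<lambda>s. f (t + s /\<^sub>R 2) * qcnj (g (t - s /\<^sub>R 2)))"
    and "(LINT s|lborel. norm (f (t + s /\<^sub>R 2) * qcnj (g (t - s /\<^sub>R 2)))) \<le> 4 * F * G"
proof -
  have L2: "(\<integral>\<^sup>+s. ennreal (norm (f (t + s /\<^sub>R 2)))^2 \<partial>lborel) = ennreal (4 * F\<^sup>2)"
    "(\<integral>\<^sup>+s. ennreal (norm (g (t - s /\<^sub>R 2)))^2 \<partial>lborel) = ennreal (4 * G\<^sup>2)"
  proof -
    \<comment> \<open>Allowing either sign of \<open>c\<close> covers both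
      \<open>t + s /\<^sub>R 2\<close> and \<open>t - s /\<^sub>R 2\<close>.\<close>
    have scale: "(\<integral>\<^sup>+s. k (t + c *\<^sub>R s) \<partial>lborel) = 4 * (\<integral>\<^sup>+x. k x \<partial>lborel)"
      if [measurable]: "k \<in> borel_measurable borel" and c: "\<bar>c\<bar>
          = 1 / 2" for k :: "real \<times> real \<Rightarrow> ennreal" and c
    proof -
      have "4 * (\<integral>\<^sup>+x. k x \<partial>lborel) = ennreal 4 * (ennreal (\<bar>c\<bar>^2) * (\<integral>\<^sup>+s. k (t + c *\<^sub>R s) \<partial>lborel))"
        using c by (subst nn_integral_lborel_affine[where c=c and t=t]) (auto simp: power2_eq_square)
      also have "\<dots> = (\<integral>\<^sup>+s. k (t + c *\<^sub>R s) \<partial>lborel)"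
        unfolding c by (simp add: power2_eq_square flip: mult.assoc ennreal_mult ennreal_numeral)
      finally show ?thesis ..
    qed
    show "(\<integral>\<^sup>+s. ennreal (norm (f (t + s /\<^sub>R 2)))^2 \<partial>lborel) = ennreal (4 * F\<^sup>2)"
      using scale[of "\<lambda>x. ennreal ((norm (f x))\<^sup>2)" "inverse 2"]
          by (simp add: f ennreal_mult ennreal_power)
    show "(\<integral>\<^sup>+s. ennreal (norm (g (t - s /\<^sub>R 2)))^2 \<partial>lborel) = ennreal (4 * G\<^sup>2)"
      using scale[of "\<lambda>x. ennreal ((norm (g x))\<^sup>2)" "- inverse 2"]
          by (simp add: g ennreal_mult ennreal_power)
  qed
  let ?h = "\<lambda>s. f (t + s /\<^sub>R 2) * qcnj (g (t - s /\<^sub>R 2))"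
  have "(\<integral>\<^sup>+s. ennreal (norm (?h s)) \<partial>lborel)\<^sup>2
    = (\<integral>\<^sup>+s. ennreal (norm (f (t + s /\<^sub>R 2))) * ennreal (norm (g (t - s /\<^sub>R 2))) \<partial>lborel)\<^sup>2"
    by (simp add: norm_mult ennreal_mult)
  also have "\<dots> \<le> ennreal (4 * F\<^sup>2) * ennreal (4 * G\<^sup>2)"
    unfolding L2[symmetric] by (rule Cauchy_Schwarz_nn_integral) measurable
  also have "\<dots> = (ennreal (4 * F * G))\<^sup>2"
    using F G by (simp add: ennreal_power flip: ennreal_mult) (simp add: power2_eq_square mult_ac)
  \<comment> \<open>The square root is taken in the extended reals by separating the value infinity,
    which the finite right side excludes.\<close>
  finally have le: "(\<integral>\<^sup>+s. ennreal (norm (?h s)) \<partial>lborel) \<le> ennreal (4 * F * G)"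
    by (cases "\<integral>\<^sup>+s. ennreal (norm (?h s)) \<partial>lborel")
      (use F G in \<open>auto simp: ennreal_power ennreal_le_iff power2_le_iff_abs_le top_unique\<close>)
  show int: "integrable lborel ?h"
    by (rule integrableI_bounded) (use le in \<open>auto intro: le_less_trans\<close>)
  have "ennreal (LINT s|lborel. norm (?h s)) = (\<integral>\<^sup>+s. ennreal (norm (?h s)) \<partial>lborel)"
    using int by (intro nn_integral_eq_integral[symmetric]) auto
  with le have "ennreal (LINT s|lborel. norm (?h s)) \<le> ennreal (4 * F * G)"
    by simp
  then show "(LINT s|lborel. norm (?h s)) \<le> 4 * F * G"
    using F G by (subst (asm) ennreal_le_iff) simp_all
qed

section \<open>The bound for the Wigner-Ville distribution\<close>

lemma wvd_qolct_bound:
  fixes f g :: "real \<times> real \<Rightarrow> quat" and p :: real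
  assumes p: "2 \<le> p" and pu: "pure_unit \<nu>" "pure_unit \<mu>" and b: "b1 \<noteq> 0" "b2 \<noteq> 0"
    and fg: "f \<in> L2_space" "g \<in> L2_space"
  shows "(\<integral>\<^sup>+ t. (\<integral>\<^sup>+ u. ennreal (norm (wvd_qolct \<nu> \<mu> (a1, b1, c1, d1, \<tau>1, \<eta>1)
            (a2, b2, c2, d2, \<tau>2, \<eta>2) f g t u) powr p) \<partial>lebesgue) \<partial>lebesgue)
      \<le> ennreal ((4 powr (p - 2) * (2 * pi)\<^sup>2) * (\<bar>b1 * b2\<bar> powr (- p / 2 + 1) / (2 * pi) powr p)
            * L2_norm f powr p * L2_norm g powr p)"
proof -
  let ?W = "wvd_qolct \<nu> \<mu> (a1, b1, c1, d1, \<tau>1, \<eta>1) (a2, b2, c2, d2, \<tau>2, \<eta>2) f g"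
  define F G where "F = L2_norm f" and "G = L2_norm g"
  have F: "F \<ge> 0" and G: "G \<ge> 0" by (simp_all add: F_def G_def L2_norm_def)
  obtain f' where f'[measurable]: "f' \<in> borel_measurable borel" and ff': "AE x in lborel. f x = f' x"
    and nf: "(\<integral>\<^sup>+x. ennreal ((norm (f' x))\<^sup>2) \<partial>lborel) = ennreal (F\<^sup>2)"
    unfolding F_def by (rule L2_space_borel[OF fg(1)])
  obtain g' where g'[measurable]: "g' \<in> borel_measurable borel" and gg': "AE x in lborel. g x = g' x"
    and ng: "(\<integral>\<^sup>+x. ennreal ((norm (g' x))\<^sup>2) \<partial>lborel) = ennreal (G\<^sup>2)"
    unfolding G_def by (rule L2_space_borel[OF fg(2)])
  note hb = cross_product_integral_bound[OF f' g' nf F ng G]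
  define h where "h t s = f' (t + s /\<^sub>R 2) * qcnj (g' (t - s /\<^sub>R 2))" for t s
  obtain p1 ch1 where p1: "\<And>y. norm (p1 y) = 1 / sqrt (2 * pi * \<bar>b1\<bar>)"
    and [measurable]: "ch1 \<in> borel_measurable borel"
    and K1: "\<And>x y. olct_kernel \<nu> (a1, b1, c1, d1, \<tau>1, \<eta>1) x y
        = p1 y * (qexp \<nu> ((- 1 / b1) * x * y) * qexp \<nu> (ch1 x))"
    by (rule olct_kernel_split[OF pu(1) b(1), where a=a1 and c=c1 and d=d1 and \<tau>=\<tau>1 and \<eta>=\<eta>1]) blast
  obtain p2 ch2 where p2: "\<And>y. norm (p2 y) = 1 / sqrt (2 * pi * \<bar>b2\<bar>)"
    and [measurable]: "ch2 \<in> borel_measurable borel"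
    and K2: "\<And>x y. olct_kernel \<mu> (a2, b2, c2, d2, \<tau>2, \<eta>2) x y
        = qexp \<mu> (ch2 x) * qexp \<mu> ((- 1 / b2) * x * y) * p2 y"
    by (rule olct_kernel_split[OF pu(2) b(2), where a=a2 and c=c2 and d=d2 and \<tau>=\<tau>2 and \<eta>=\<eta>2]) blast
  \<comment> \<open>Both chirps are absorbed into \<open>h t\<close>. They are unimodular, so
    \<open>H t\<close> has the same pointwise norm, and what remains is a pure two-sided Fourier
    transform.\<close>
  define H where "H t s = qexp \<nu> (ch1 (fst s)) * h t s * qexp \<mu> (ch2 (snd s))" for t s
  have [measurable]: "h t \<in> borel_measurable borel" "H t \<in> borel_measurable borel" for t
    unfolding H_def h_def by measurable
  have norm_H: "norm (H t s) = norm (f' (t + s /\<^sub>R 2)) * norm (g' (t - s /\<^sub>R 2))" for t s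
    by (simp add: H_def h_def norm_mult norm_qexp pu)
  have int_H: "integrable lborel (H t)" for t
    by (rule Bochner_Integration.integrable_bound[OF hb(1)[of t]]) (auto simp: norm_H norm_mult)
  define X where "X t u s = qexp \<nu> ((- 1 / b1) * fst s * fst u) * H t s * qexp \<mu> ((- 1 / b2) * snd s
      * snd u)" for t u s
  define T where "T t u = (LINT s|lborel. X t u s)" for t u
  have [measurable]: "X t u \<in> borel_measurable borel" "T t \<in> borel_measurable borel" for t u
    unfolding T_def X_def by measurable
  have norm_X: "norm (X t u s) = norm (H t s)" for t u s
    by (simp add: X_def norm_mult norm_qexp pu)
  have int_X: "integrable lborel (X t u)" for t u
    by (rule Bochner_Integration.integrable_bound[OF int_H[of t]]) (auto simp: norm_X)
  \<comment> \<open>The outer factors depend on \<open>u\<close> only and leave the integral, the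
    first to the left and the second to the right.\<close>
  have W: "?W t u = p1 (fst u) * T t u * p2 (snd u)" for t u
  proof -
    have eq: "AE s in lborel. f (t + s /\<^sub>R 2) = f' (t + s /\<^sub>R 2)" "AE s in lborel. g (t - s /\<^sub>R 2)
        = g' (t - s /\<^sub>R 2)"
      using AE_lborel_affine[OF ff', of "1 / 2" t] AE_lborel_affine[OF gg', of "- (1 / 2)" t]
          by simp_all
    have "?W t u = (LINT s|lborel. p1 (fst u) * X t u s * p2 (snd u))"
      unfolding wvd_qolct_def
    proof (rule integral_lebesgue_cong_borel)
      show "(\<lambda>s. p1 (fst u) * X t u s * p2 (snd u)) \<in> borel_measurable borel" by measurable
      show "AE s in lborel. olct_kernel \<nu> (a1, b1, c1, d1, \<tau>1, \<eta>1) (fst s) (fst u) * f (t + s /\<^sub>R 2) *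
          qcnj (g (t - s /\<^sub>R 2)) * olct_kernel \<mu> (a2, b2, c2, d2, \<tau>2, \<eta>2) (snd s) (snd u)
        = p1 (fst u) * X t u s * p2 (snd u)"
        using eq by eventually_elim (simp only: K1 K2 X_def H_def h_def mult.assoc)
    qed
    then show ?thesis using int_X by (simp add: T_def)
  qed
  have T_le: "norm (T t u) \<le> 4 * F * G" for t u
  proof -
    have "norm (T t u) \<le> (LINT s|lborel. norm (X t u s))"
      unfolding T_def by (rule integral_norm_bound)
    also have "\<dots> \<le> 4 * F * G"
      using hb(2)[of t] by (simp add: norm_X norm_H norm_mult)
    finally show ?thesis .
  qed
  \<comment> \<open>The moduli of the two prefactors enter with power \<open>p\<close>; the uniform
    bound on \<open>T\<close> enters with power \<open>p - 2\<close>, leaving a square for the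
    Plancherel inequality.\<close>
  define c where "c = (1 / (2 * pi * sqrt \<bar>b1 * b2\<bar>)) powr p * (4 * F * G) powr (p - 2)"
  have c: "c \<ge> 0" by (simp add: c_def)
  have W_le: "norm (?W t u) powr p \<le> c * (norm (T t u))\<^sup>2" for t u
  proof -
    have "sqrt (2 * pi * \<bar>b1\<bar>) * sqrt (2 * pi * \<bar>b2\<bar>) = sqrt ((2 * pi)\<^sup>2 * \<bar>b1 * b2\<bar>)"
      unfolding real_sqrt_mult[symmetric] by (simp add: power2_eq_square abs_mult mult_ac)
    also have "\<dots> = 2 * pi * sqrt \<bar>b1 * b2\<bar>"
      by (simp add: real_sqrt_mult)
    finally have eq: "sqrt (2 * pi * \<bar>b1\<bar>) * sqrt (2 * pi * \<bar>b2\<bar>) = 2 * pi * sqrt \<bar>b1 * b2\<bar>" .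
    have "norm (?W t u) = 1 / (2 * pi * sqrt \<bar>b1 * b2\<bar>) * norm (T t u)"
      unfolding W norm_mult p1 p2 eq[symmetric] by simp
    then have "norm (?W t u) powr p = (1 / (2 * pi * sqrt \<bar>b1 * b2\<bar>)) powr p
        * (norm (T t u) powr (p - 2) * (norm (T t u))\<^sup>2)"
      by (simp only: powr_minus_two_mult norm_ge_zero powr_mult)
    also have "\<dots> \<le> (1 / (2 * pi * sqrt \<bar>b1 * b2\<bar>)) powr p * ((4 * F * G) powr (p - 2)
        * (norm (T t u))\<^sup>2)"
      using p by (intro mult_left_mono mult_right_mono powr_mono2 T_le) auto
    finally show ?thesis by (simp add: c_def)
  qed
  define I where "I t = (\<integral>\<^sup>+s. ennreal ((norm (f' (t + s /\<^sub>R 2)))\<^sup>2)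
      * ennreal ((norm (g' (t - s /\<^sub>R 2)))\<^sup>2) \<partial>lborel)" for t
  have [measurable]: "I \<in> borel_measurable borel" unfolding I_def by measurable
  \<comment> \<open>The Plancherel inequality with frequencies \<open>- 1 / b1\<close> and
    \<open>- 1 / b2\<close> gives the factor \<open>\<bar>b1 * b2\<bar>\<close>; \<open>I t\<close>
    is the squared norm of \<open>H t\<close>.\<close>
  have inner_le: "(\<integral>\<^sup>+ u. ennreal (norm (?W t u) powr p) \<partial>lebesgue)
      \<le> ennreal (c * ((2 * pi)\<^sup>2 * \<bar>b1 * b2\<bar>)) * I t" for t
  proof -
    have "(\<integral>\<^sup>+ u. ennreal (norm (?W t u) powr p) \<partial>lebesgue)
        \<le> (\<integral>\<^sup>+ u. ennreal (c * (norm (T t u))\<^sup>2) \<partial>lborel)"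
      unfolding nn_integral_completion by (intro nn_integral_mono ennreal_leI W_le)
    also have "\<dots> = ennreal c * (\<integral>\<^sup>+ u. ennreal ((norm (T t u))\<^sup>2) \<partial>lborel)"
      using c by (simp add: ennreal_mult nn_integral_cmult)
    also have "\<dots> \<le> ennreal c * (ennreal ((2 * pi)\<^sup>2 / \<bar>(- 1 / b1) * (- 1 / b2)\<bar>) *
        (\<integral>\<^sup>+s. ennreal ((norm (H t s))\<^sup>2) \<partial>lborel))"
      unfolding T_def X_def using b by (intro mult_left_mono quat_fourier_bessel int_H pu) auto
    also have "(\<integral>\<^sup>+s. ennreal ((norm (H t s))\<^sup>2) \<partial>lborel) = I t"
      by (simp add: I_def norm_H power_mult_distrib ennreal_mult)
    also have "ennreal c * (ennreal ((2 * pi)\<^sup>2 / \<bar>(- 1 / b1) * (- 1 / b2)\<bar>) * I t)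
        = ennreal (c * ((2 * pi)\<^sup>2 * \<bar>b1 * b2\<bar>)) * I t"
      using c by (simp add: ennreal_mult abs_mult mult.assoc)
    finally show ?thesis .
  qed
  have "(\<integral>\<^sup>+ t. (\<integral>\<^sup>+ u. ennreal (norm (?W t u) powr p) \<partial>lebesgue) \<partial>lebesgue)
    \<le> (\<integral>\<^sup>+ t. ennreal (c * ((2 * pi)\<^sup>2 * \<bar>b1 * b2\<bar>)) * I t \<partial>lborel)"
    unfolding nn_integral_completion[where f="\<lambda>t. \<integral>\<^sup>+ u. _ t u \<partial>lebesgue"]
        by (intro nn_integral_mono inner_le)
  also have "\<dots> = ennreal (c * ((2 * pi)\<^sup>2 * \<bar>b1 * b2\<bar>)) * (ennreal (F\<^sup>2) * ennreal (G\<^sup>2))"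
    by (simp add: nn_integral_cmult)
      (simp add: I_def nn_integral_product_cross[of "\<lambda>x. ennreal ((norm (f' x))\<^sup>2)"
          "\<lambda>x. ennreal ((norm (g' x))\<^sup>2)", simplified] nf ng)
  also have "\<dots> = ennreal (c * ((2 * pi)\<^sup>2 * \<bar>b1 * b2\<bar>) * (F\<^sup>2 * G\<^sup>2))"
    using c by (simp flip: ennreal_mult)
  \<comment> \<open>The prefactors give \<open>\<bar>b1 * b2\<bar>\<close> to the power
    \<open>- p / 2\<close> and Plancherel gives one more power. The exponents \<open>p - 2\<close>
    and 2 of \<open>F\<close> and \<open>G\<close> combine to \<open>p\<close>.\<close>
  also have "c * ((2 * pi)\<^sup>2 * \<bar>b1 * b2\<bar>) * (F\<^sup>2 * G\<^sup>2)
    = (4 powr (p - 2) * (2 * pi)\<^sup>2) * (\<bar>b1 * b2\<bar> powr (- p / 2 + 1) / (2 * pi) powr p) * F powr p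
        * G powr p"
  proof -
    have bb: "\<bar>b1 * b2\<bar> > 0" using b by simp
    have "sqrt \<bar>b1 * b2\<bar> powr p = \<bar>b1 * b2\<bar> powr (p / 2)"
      using bb by (simp add: powr_powr flip: powr_half_sqrt)
    then have "(1 / (2 * pi * sqrt \<bar>b1 * b2\<bar>)) powr p = 1 / ((2 * pi) powr p * \<bar>b1 * b2\<bar> powr (p / 2))"
      by (simp only: powr_divide powr_mult powr_one_eq_one)
    moreover have "(4 * F * G) powr (p - 2) = 4 powr (p - 2) * F powr (p - 2) * G powr (p - 2)"
      using F G by (simp add: powr_mult)
    moreover have "\<bar>b1 * b2\<bar> powr (- p / 2 + 1) = \<bar>b1 * b2\<bar> / \<bar>b1 * b2\<bar> powr (p / 2)"
      using bb by (simp add: powr_diff)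
    ultimately show ?thesis
      unfolding c_def powr_minus_two_mult[OF F, of p, symmetric] powr_minus_two_mult[OF G, of p,
          symmetric]
      by (simp only: times_divide_eq_left times_divide_eq_right divide_divide_eq_left mult_1_left
          mult_ac)
  qed
  finally show ?thesis unfolding F_def G_def .
qed

theorem theorem4p12:
  fixes p :: real
  assumes "2 \<le> p"
  shows "\<exists>C::real. C > 0 \<and>
    (\<forall>\<nu> \<mu> a1 b1 c1 d1 \<tau>1 \<eta>1 a2 b2 c2 d2 \<tau>2 \<eta>2 f g.
      pure_unit \<nu> \<longrightarrow> pure_unit \<mu> \<longrightarrow>
      a1 * d1 - b1 * c1 = 1 \<longrightarrow> b1 \<noteq> 0 \<longrightarrow>
      a2 * d2 - b2 * c2 = 1 \<longrightarrow> b2 \<noteq> 0 \<longrightarrow>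
      f \<in> L2_space \<longrightarrow> g \<in> L2_space \<longrightarrow>
      (\<integral>\<^sup>+ t. (\<integral>\<^sup>+ u. ennreal (norm (wvd_qolct \<nu> \<mu> (a1, b1, c1, d1, \<tau>1, \<eta>1)
            (a2, b2, c2, d2, \<tau>2, \<eta>2) f g t u) powr p) \<partial>lebesgue) \<partial>lebesgue)
      \<le> ennreal (C * (\<bar>b1 * b2\<bar> powr (- p / 2 + 1) / (2 * pi) powr p)
            * L2_norm f powr p * L2_norm g powr p))"
  \<comment> \<open>In the witness, \<open>4 powr (p - 2)\<close> comes from the uniform bound and
    \<open>(2 * pi)\<^sup>2\<close> from the Plancherel inequality.\<close>
  by (rule exI[of _ "4 powr (p - 2) * (2 * pi)\<^sup>2"]) (intro conjI allI impI wvd_qolct_bound assms; simp)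

end
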